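(* Let $\Gamma=(\mathcal{V},\mathcal{E})$ be a $G$-flag-transitive $q$-graph on $V=\mathbb{F}_q^n$, where $G\leqslant\mathrm{Aut}(\Gamma)$. Then $\mathcal{P}=(\mathcal{V},\mathcal{E},\mathrm{I})$ is a $G$-flag-transitive partial linear space, where the incidence relation $\mathrm{I}$ is given by symmetrised containment.
   Context: $\Gamma\mathrm{L}_n(q)$ is the group of all invertible semilinear transformations of $\mathbb{F}_q^n$. A $q$-graph on $V=\mathbb{F}_q^n$ is a pair $\Gamma=(\mathcal{V},\mathcal{E})$, where $\mathcal{V}$ is the set of all $1$-dimensional subspaces of $V$ (vertices) and $\mathcal{E}$ is a subset of the set of $2$-dimensional subspaces of $V$ (edges). $\mathrm{Aut}(\Gamma)$ is the setwise stabiliser of $\mathcal{E}$ in $\Gamma\mathrm{L}_n(q)$. For $G\leqslant\mathrm{Aut}(\Gamma)$, $\Gamma$ is $G$-flag-transitive if $G$ acts transitively on the set of pairs $(X,U)\in\mathcal{V}\times\mathcal{E}$ with $X\leqslant U$. A partial linear space is an incidence structure (points, lines, incidence) in which any pair of (distinct) points is contained in $0$ or $1$ lines. In $\mathcal{P}$ the points are the elements of $\mathcal{V}$, the lines are the elements of $\mathcal{E}$, and a point $X$ and a line $U$ are incident if and only if $X\leqslant U$. It is $G$-flag-transitive if $G$ acts on it as a group of automorphisms that is transitive on incident point-line pairs. *)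

theory Defs
  imports "HOL-Analysis.Cartesian_Space" "HOL-Algebra.Group_Action"
begin

text \<open>The space \<open>F\<^sub>q\<^sup>n\<close> is \<open>'a ^ 'n\<close> with \<open>'a\<close> a finite field,
  so that \<open>q = CARD('a)\<close> and \<open>n = CARD('n) \<ge> 1\<close>.\<close>

definition field_automorphism :: "('a::field \<Rightarrow> 'a) \<Rightarrow> bool" where
  "field_automorphism s \<longleftrightarrow>
     bij s \<and> s 1 = 1 \<and> (\<forall>a b. s (a + b) = s a + s b) \<and> (\<forall>a b. s (a * b) = s a * s b)"

definition semilinear :: "('a::field ^ 'n \<Rightarrow> 'a ^ 'n) \<Rightarrow> bool" where
  "semilinear f \<longleftrightarrow> (\<forall>x y. f (x + y) = f x + f y) \<and>
     (\<exists>s. field_automorphism s \<and> (\<forall>c x. f (c *s x) = s c *s f x))"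

definition GammaL :: "('a::field ^ 'n \<Rightarrow> 'a ^ 'n) monoid" where
  "GammaL = \<lparr>carrier = {f. bij f \<and> semilinear f}, mult = (\<circ>), one = id\<rparr>"


record 'v q_graph =
  vertices :: "'v set set"
  edges :: "'v set set"

definition is_q_graph :: "('a::field ^ 'n) q_graph \<Rightarrow> bool" where
  "is_q_graph \<Gamma> \<longleftrightarrow>
     vertices \<Gamma> = {X. vec.subspace X \<and> vec.dim X = 1} \<and>
     edges \<Gamma> \<subseteq> {U. vec.subspace U \<and> vec.dim U = 2}"

definition q_graph_Aut :: "('a::field ^ 'n) q_graph \<Rightarrow> ('a ^ 'n \<Rightarrow> 'a ^ 'n) monoid" where
  "q_graph_Aut \<Gamma> = GammaL\<lparr>carrier := stabilizer GammaL (\<lambda>g F. (`) g ` F) (edges \<Gamma>)\<rparr>"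

definition q_graph_flag_transitive ::
    "('a::field ^ 'n \<Rightarrow> 'a ^ 'n) set \<Rightarrow> ('a ^ 'n) q_graph \<Rightarrow> bool" where
  "q_graph_flag_transitive G \<Gamma> \<longleftrightarrow>
     (\<forall>X \<in> vertices \<Gamma>. \<forall>U \<in> edges \<Gamma>. \<forall>Y \<in> vertices \<Gamma>. \<forall>W \<in> edges \<Gamma>.
        X \<subseteq> U \<longrightarrow> Y \<subseteq> W \<longrightarrow> (\<exists>g \<in> G. g ` X = Y \<and> g ` U = W))"


text \<open>Points and lines live in one type so that incidence can be a symmetric relation
  on the union of the two (disjoint) sets.\<close>

record 'p incidence_struct =
  points :: "'p set"
  lines :: "'p set"
  incidence :: "('p \<times> 'p) set"

definition is_incidence_structure :: "'p incidence_struct \<Rightarrow> bool" where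
  "is_incidence_structure S \<longleftrightarrow> points S \<inter> lines S = {} \<and>
     incidence S \<subseteq> points S \<times> lines S \<union> lines S \<times> points S \<and> sym (incidence S)"

definition partial_linear_space :: "'p incidence_struct \<Rightarrow> bool" where
  "partial_linear_space S \<longleftrightarrow> is_incidence_structure S \<and>
     (\<forall>x \<in> points S. \<forall>y \<in> points S. x \<noteq> y \<longrightarrow>
        (\<exists>\<^sub>\<le>\<^sub>1 l. l \<in> lines S \<and> (x, l) \<in> incidence S \<and> (y, l) \<in> incidence S))"

definition incidence_automorphisms :: "'p incidence_struct \<Rightarrow> ('p \<Rightarrow> 'p) set" where
  "incidence_automorphisms S = {f \<in> Bij (points S \<union> lines S).
     f ` points S = points S \<and> f ` lines S = lines S \<and>
     (\<forall>x \<in> points S \<union> lines S. \<forall>y \<in> points S \<union> lines S.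
        (f x, f y) \<in> incidence S \<longleftrightarrow> (x, y) \<in> incidence S)}"

text \<open>The action \<open>\<phi>\<close> is a homomorphism into the automorphism group and
  need not be faithful: on subspaces, scalars act trivially.\<close>

definition flag_transitive_partial_linear_space ::
    "('g, 'm) monoid_scheme \<Rightarrow> ('g \<Rightarrow> 'p \<Rightarrow> 'p) \<Rightarrow> 'p incidence_struct \<Rightarrow> bool" where
  "flag_transitive_partial_linear_space G \<phi> S \<longleftrightarrow>
     partial_linear_space S \<and>
     group_action G (points S \<union> lines S) \<phi> \<and>
     (\<forall>g \<in> carrier G. \<phi> g \<in> incidence_automorphisms S) \<and>
     (\<forall>x \<in> points S. \<forall>l \<in> lines S. \<forall>y \<in> points S. \<forall>m \<in> lines S.
        (x, l) \<in> incidence S \<longrightarrow> (y, m) \<in> incidence S \<longrightarrow>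
        (\<exists>g \<in> carrier G. \<phi> g x = y \<and> \<phi> g l = m))"

definition q_graph_space :: "'v q_graph \<Rightarrow> 'v set incidence_struct" where
  "q_graph_space \<Gamma> =
     \<lparr>points = vertices \<Gamma>, lines = edges \<Gamma>,
      incidence = (let I = {(X, U). X \<in> vertices \<Gamma> \<and> U \<in> edges \<Gamma> \<and> X \<subseteq> U} in I \<union> I\<inverse>)\<rparr>"

text \<open>Restricted because the permutations in \<open>Bij A\<close> are required to be extensional on \<open>A\<close>.\<close>

definition subspace_action :: "'v q_graph \<Rightarrow> ('v \<Rightarrow> 'v) \<Rightarrow> 'v set \<Rightarrow> 'v set" where
  "subspace_action \<Gamma> g = (\<lambda>X \<in> vertices \<Gamma> \<union> edges \<Gamma>. g ` X)"

end

theory Submission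
  imports Defs
begin

text \<open>Two distinct points in a common line span it by comparing dimensions, so that line is unique;
  bijective semilinear maps preserve dimension, so they act on the incidence structure.\<close>

section \<open>Semilinear maps, subspaces and dimension\<close>

lemma field_automorphism_comp:
  "field_automorphism s \<Longrightarrow> field_automorphism t \<Longrightarrow> field_automorphism (s \<circ> t)"
  by (auto simp: field_automorphism_def bij_comp)

lemma field_automorphism_inv:
  assumes "field_automorphism s"
  shows "field_automorphism (inv_into UNIV s)"
proof -
  have "bij s" and [simp]: "s 1 = 1" "s (a + b) = s a + s b" "s (a * b) = s a * s b" for a b
    using assms by (auto simp: field_automorphism_def)
  then have [simp]: "s (inv_into UNIV s a) = a" for a
    by (simp add: bij_is_surj surj_f_inv_f)
  show ?thesis
    unfolding field_automorphism_def
    by (intro conjI allI bij_imp_bij_inv \<open>bij s\<close> inv_f_eq bij_is_inj) simp_all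
qed

lemma semilinear_add: "semilinear f \<Longrightarrow> f (x + y) = f x + f y"
  by (simp add: semilinear_def)

lemma semilinear_zero: "semilinear f \<Longrightarrow> f 0 = 0"
  using semilinear_add[of f 0 0] by simp

lemma semilinear_id: "semilinear id"
  unfolding semilinear_def by (auto simp: field_automorphism_def intro!: exI[of _ id])

lemma semilinear_comp:
  assumes "semilinear f" "semilinear g"
  shows "semilinear (f \<circ> g)"
proof -
  obtain s t where "field_automorphism s" "\<And>c x. f (c *s x) = s c *s f x"
    and "field_automorphism t" "\<And>c x. g (c *s x) = t c *s g x"
    using assms unfolding semilinear_def by blast
  then show ?thesis
    using assms unfolding semilinear_def
    by (auto intro!: exI[of _ "s \<circ> t"] field_automorphism_comp)
qed

lemma semilinear_inv:
  assumes "semilinear f" "bij f"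
  shows "semilinear (inv_into UNIV f)"
proof -
  obtain s where s: "field_automorphism s" "\<And>c x. f (c *s x) = s c *s f x"
    using assms unfolding semilinear_def by blast
  have f: "f (inv_into UNIV f x) = x" for x
    using assms(2) by (simp add: bij_is_surj surj_f_inv_f)
  have "s (inv_into UNIV s c) = c" for c
    using s(1) by (simp add: field_automorphism_def bij_is_surj surj_f_inv_f)
  \<comment> \<open>The inverse is semilinear for the inverse twist. By injectivity of
    \<open>f\<close> it suffices to apply \<open>f\<close> to the right-hand side, where
    \<open>s\<close> and its inverse cancel; additivity below is checked the same way.\<close>
  then have "inv_into UNIV f (c *s x) = inv_into UNIV s c *s inv_into UNIV f x" for c x
    by (intro inv_f_eq bij_is_inj assms(2)) (simp add: s(2) f)
  moreover have "inv_into UNIV f (x + y) = inv_into UNIV f x + inv_into UNIV f y" for x y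
    by (intro inv_f_eq bij_is_inj assms(2)) (simp add: semilinear_add[OF assms(1)] f)
  ultimately show ?thesis
    unfolding semilinear_def using field_automorphism_inv[OF s(1)] by blast
qed

lemma subspace_semilinear_image:
  assumes "semilinear f" "vec.subspace X"
  shows "vec.subspace (f ` X)"
proof -
  obtain s where s: "bij s" "\<And>c x. f (c *s x) = s c *s f x"
    using assms(1) unfolding semilinear_def field_automorphism_def by blast
  \<comment> \<open>Surjectivity of the twist \<open>s\<close> matters here: every scalar has the
    form \<open>s d\<close>, so closure of \<open>X\<close> under scalars passes to its
    image.\<close>
  have "c *s f x = f (inv_into UNIV s c *s x)" for c x
    using s by (simp add: bij_is_surj surj_f_inv_f)
  then show ?thesis
    using assms(2) unfolding vec.subspace_def
    by (auto simp: semilinear_add[OF assms(1), symmetric]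
        intro!: imageI image_eqI[of 0 f 0] semilinear_zero[OF assms(1), symmetric])
qed

text \<open>A basis of \<open>X\<close> is carried to a set spanning the image: the twist changes
  the coefficients of a linear combination, but not the vectors it is built from.\<close>

lemma dim_semilinear_image_le:
  fixes X :: "('a::field ^ 'n) set"
  assumes "semilinear f"
  shows "vec.dim (f ` X) \<le> vec.dim X"
proof -
  obtain B where B: "B \<subseteq> X" "vec.independent B" "X \<subseteq> vec.span B" "card B = vec.dim X"
    using vec.basis_exists by blast
  obtain s where s: "\<And>c x. f (c *s x) = s c *s f x"
    using assms unfolding semilinear_def by blast
  have "f x \<in> vec.span (f ` B)" if "x \<in> vec.span B" for x
    using that
    by (induction rule: vec.span_induct_alt)
      (simp_all add: semilinear_zero[OF assms] semilinear_add[OF assms] s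
        vec.span_zero vec.span_add vec.span_scale vec.span_base)
  then have sub: "f ` X \<subseteq> vec.span (f ` B)"
    using B(3) by blast
  have "finite B"
    using B(2) by (rule vec.finiteI_independent)
  then have "vec.dim (f ` X) \<le> card (f ` B)"
    using sub by (intro vec.dim_le_card) auto
  also have "\<dots> \<le> card B"
    using \<open>finite B\<close> by (rule card_image_le)
  finally show ?thesis
    using B(4) by simp
qed

lemma dim_semilinear_image:
  assumes "semilinear f" "bij f"
  shows "vec.dim (f ` X) = vec.dim X"
proof (rule antisym)
  \<comment> \<open>The reverse inequality is the previous bound for the inverse map, applied to the
    image of \<open>X\<close>.\<close>
  have "inv_into UNIV f ` f ` X = X"
    using assms(2) by (simp add: bij_is_inj image_inv_f_f)
  then show "vec.dim X \<le> vec.dim (f ` X)"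
    using dim_semilinear_image_le[OF semilinear_inv[OF assms], of "f ` X"] by simp
qed (rule dim_semilinear_image_le[OF assms(1)])

section \<open>The semilinear group and the automorphism group of a q-graph\<close>

lemma group_GammaL: "group (GammaL :: ('a::field ^ 'n \<Rightarrow> 'a ^ 'n) monoid)"
proof (rule groupI)
  fix f :: "'a ^ 'n \<Rightarrow> 'a ^ 'n" assume "f \<in> carrier GammaL"
  then have "inv_into UNIV f \<in> carrier GammaL" "inv_into UNIV f \<circ> f = id"
    by (auto simp: GammaL_def semilinear_inv bij_imp_bij_inv bij_is_inj)
  then show "\<exists>g\<in>carrier GammaL. g \<otimes>\<^bsub>GammaL\<^esub> f = \<one>\<^bsub>GammaL\<^esub>"
    by (auto simp: GammaL_def)
qed (auto simp: GammaL_def semilinear_id semilinear_comp bij_comp o_assoc)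

text \<open>The edge set is a single point of this action on families of sets of vectors, so its
  setwise stabiliser is a point stabiliser and hence a subgroup.\<close>

lemma group_action_image_GammaL:
  "group_action (GammaL :: ('a::field ^ 'n \<Rightarrow> 'a ^ 'n) monoid) UNIV (\<lambda>g F. (`) g ` F)"
proof -
  have bij: "bij (\<lambda>F. (`) g ` F)" if "bij g" for g :: "'a ^ 'n \<Rightarrow> 'a ^ 'n"
    \<comment> \<open>The power set rule is used twice: from vectors to sets of vectors, then to
      families of such sets.\<close>
    using that by (intro bij_betw_Pow[of _ UNIV UNIV, simplified])
  have "(\<lambda>g F. (`) g ` F) \<in> hom (GammaL :: ('a ^ 'n \<Rightarrow> 'a ^ 'n) monoid) (BijGroup UNIV)"
    by (intro homI)
      (auto simp: bij GammaL_def BijGroup_def Bij_def compose_def fun_eq_iff image_comp bij_comp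
        image_image)
  then show ?thesis
    unfolding group_action_def group_hom_def group_hom_axioms_def
    using group_GammaL group_BijGroup by blast
qed

lemma group_q_graph_Aut: "group (q_graph_Aut \<Gamma>)"
  unfolding q_graph_Aut_def
  by (intro group.subgroup_imp_group[OF group_GammaL]
      group_action.stabilizer_subgroup[OF group_action_image_GammaL]) simp

lemma q_graph_AutD:
  assumes "g \<in> carrier (q_graph_Aut \<Gamma>)"
  shows "bij g" "semilinear g" "(`) g ` edges \<Gamma> = edges \<Gamma>"
  using assms by (auto simp: q_graph_Aut_def stabilizer_def GammaL_def)

text \<open>Automorphisms fix the edge set by definition. For the vertices this follows because they
  are all the one-dimensional subspaces, and \<open>g\<close> and its inverse both preserve
  subspaces and dimension.\<close>

lemma q_graph_Aut_image_vertices: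
  assumes "is_q_graph \<Gamma>" "g \<in> carrier (q_graph_Aut \<Gamma>)"
  shows "(`) g ` vertices \<Gamma> = vertices \<Gamma>"
proof
  note g = q_graph_AutD(1,2)[OF assms(2)]
  have V: "f ` X \<in> vertices \<Gamma>" if "bij f" "semilinear f" "X \<in> vertices \<Gamma>" for f X
    using that assms(1)
    by (auto simp: is_q_graph_def subspace_semilinear_image dim_semilinear_image)
  show "(`) g ` vertices \<Gamma> \<subseteq> vertices \<Gamma>"
    using V[OF g] by blast
  show "vertices \<Gamma> \<subseteq> (`) g ` vertices \<Gamma>"
  proof
    fix X assume "X \<in> vertices \<Gamma>"
    then have "inv_into UNIV g ` X \<in> vertices \<Gamma>"
      using V g by (simp add: bij_imp_bij_inv semilinear_inv)
    moreover have "X = g ` inv_into UNIV g ` X"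
      using g(1) by (simp add: bij_is_surj image_f_inv_f)
    ultimately show "X \<in> (`) g ` vertices \<Gamma>"
      by blast
  qed
qed

section \<open>Points, lines and the partial linear space axiom\<close>

lemma vertices_edges_disjoint: "is_q_graph \<Gamma> \<Longrightarrow> vertices \<Gamma> \<inter> edges \<Gamma> = {}"
  by (fastforce simp: is_q_graph_def)

text \<open>Symmetrising adds only pairs with an edge first and a vertex second; disjointness of the
  two sets keeps a vertex-edge pair from arising that way.\<close>

lemma incidence_q_graph_space_iff:
  assumes "is_q_graph \<Gamma>" "X \<in> vertices \<Gamma>" "U \<in> edges \<Gamma>"
  shows "(X, U) \<in> incidence (q_graph_space \<Gamma>) \<longleftrightarrow> X \<subseteq> U"
  using assms(2,3) vertices_edges_disjoint[OF assms(1)] by (auto simp: q_graph_space_def Let_def)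

lemma span_two_points_eq_line:
  fixes X Y U :: "('a::field ^ 'n) set"
  assumes "vec.subspace X" "vec.dim X = 1" "vec.subspace Y" "vec.dim Y = 1" "X \<noteq> Y"
    and "vec.subspace U" "vec.dim U = 2" "X \<subseteq> U" "Y \<subseteq> U"
  shows "U = vec.span (X \<union> Y)"
proof -
  \<comment> \<open>Containment between subspaces of equal dimension would force
    \<open>X = Y\<close>. Hence the joint span is strictly larger than \<open>X\<close> and has
    dimension at least 2, which fills \<open>U\<close>.\<close>
  have "\<not> Y \<subseteq> X"
    using assms(1-5) vec.subspace_dim_equal[of Y X] by auto
  then have "vec.span X \<subset> vec.span (X \<union> Y)"
    using assms(1) vec.span_superset[of "X \<union> Y"]
    by (auto simp: vec.span_eq_iff[THEN iffD2])
  from vec.dim_psubset[OF this] have "2 \<le> vec.dim (X \<union> Y)"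
    using assms(2) by simp
  moreover have "vec.span (X \<union> Y) \<subseteq> U"
    using assms by (intro vec.span_minimal) auto
  ultimately show ?thesis
    using vec.subspace_dim_equal[of "vec.span (X \<union> Y)" U] assms(6,7) by simp
qed

lemma partial_linear_space_q_graph_space:
  assumes "is_q_graph \<Gamma>"
  shows "partial_linear_space (q_graph_space \<Gamma>)"
proof -
  have "is_incidence_structure (q_graph_space \<Gamma>)"
    using vertices_edges_disjoint[OF assms]
    by (auto simp: is_incidence_structure_def q_graph_space_def Let_def sym_def)
  moreover have "\<exists>\<^sub>\<le>\<^sub>1 U. U \<in> edges \<Gamma> \<and> (X, U) \<in> incidence (q_graph_space \<Gamma>) \<and>
      (Y, U) \<in> incidence (q_graph_space \<Gamma>)"
    if "X \<in> vertices \<Gamma>" "Y \<in> vertices \<Gamma>" "X \<noteq> Y" for X Y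
  proof -
    have "U = vec.span (X \<union> Y)" if "U \<in> edges \<Gamma>" "X \<subseteq> U" "Y \<subseteq> U" for U
    proof (rule span_two_points_eq_line)
      show "vec.subspace U" "vec.dim U = 2"
        using \<open>U \<in> edges \<Gamma>\<close> assms by (auto simp: is_q_graph_def)
    qed (use that \<open>X \<in> vertices \<Gamma>\<close> \<open>Y \<in> vertices \<Gamma>\<close> \<open>X \<noteq> Y\<close> assms in
        \<open>simp_all add: is_q_graph_def\<close>)
    \<comment> \<open>The span depends on \<open>X\<close> and \<open>Y\<close> alone, so any two
      common lines coincide.\<close>
    then show ?thesis
      using that incidence_q_graph_space_iff[OF assms] by (intro Uniq_I) metis
  qed
  ultimately show ?thesis
    by (simp add: partial_linear_space_def q_graph_space_def)
qed

section \<open>The induced action on points and lines\<close>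

lemma subspace_action_incidence_automorphism:
  assumes "is_q_graph \<Gamma>" "g \<in> carrier (q_graph_Aut \<Gamma>)"
  shows "subspace_action \<Gamma> g \<in> incidence_automorphisms (q_graph_space \<Gamma>)"
proof -
  let ?f = "subspace_action \<Gamma> g" and ?V = "vertices \<Gamma>" and ?E = "edges \<Gamma>"
  have "inj g" and E: "(`) g ` ?E = ?E" and V: "(`) g ` ?V = ?V"
    using q_graph_AutD[OF assms(2)] q_graph_Aut_image_vertices[OF assms] by (auto simp: bij_is_inj)
  have fV: "?f ` ?V = ?V" and fE: "?f ` ?E = ?E"
    using V E by (auto simp: subspace_action_def cong: image_cong_simp)
  have "inj_on ?f (?V \<union> ?E)"
    using \<open>inj g\<close> by (auto simp: inj_on_def subspace_action_def inj_image_eq_iff)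
  then have "?f \<in> Bij (?V \<union> ?E)"
    using fV fE by (simp add: Bij_def bij_betw_def image_Un) (simp add: subspace_action_def)
  moreover have "(?f X, ?f Y) \<in> incidence (q_graph_space \<Gamma>) \<longleftrightarrow>
      (X, Y) \<in> incidence (q_graph_space \<Gamma>)"
    if "X \<in> ?V \<union> ?E" "Y \<in> ?V \<union> ?E" for X Y
  proof -
    \<comment> \<open>Injectivity on subspaces lets membership in the invariant sets
      \<open>?V\<close> and \<open>?E\<close> be reflected as well as preserved, which gives both
      directions of the incidence equivalence.\<close>
    have "inj ((`) g)"
      using \<open>inj g\<close> by (simp add: inj_def inj_image_eq_iff)
    then have "g ` Z \<in> ?V \<longleftrightarrow> Z \<in> ?V" "g ` Z \<in> ?E \<longleftrightarrow> Z \<in> ?E" for Z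
      using inj_image_mem_iff[of "(`) g" Z] V E by metis+
    moreover have "?f X = g ` X" "?f Y = g ` Y"
      using that by (simp_all add: subspace_action_def)
    ultimately show ?thesis
      by (simp add: q_graph_space_def Let_def inj_image_subset_iff[OF \<open>inj g\<close>])
  qed
  ultimately show ?thesis
    unfolding incidence_automorphisms_def using fV fE by (simp add: q_graph_space_def)
qed

lemma group_action_subspace_action:
  assumes "is_q_graph \<Gamma>" "subgroup G (q_graph_Aut \<Gamma>)"
  shows "group_action ((q_graph_Aut \<Gamma>)\<lparr>carrier := G\<rparr>) (vertices \<Gamma> \<union> edges \<Gamma>) (subspace_action \<Gamma>)"
proof -
  let ?P = "vertices \<Gamma> \<union> edges \<Gamma>"
  have G: "g \<in> carrier (q_graph_Aut \<Gamma>)" if "g \<in> G" for g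
    using that assms(2) by (rule subgroup.mem_carrier[rotated])
  have Bij: "subspace_action \<Gamma> g \<in> Bij ?P" if "g \<in> G" for g
    using subspace_action_incidence_automorphism[OF assms(1) G[OF that]]
    by (simp add: incidence_automorphisms_def q_graph_space_def)
  have P: "h ` X \<in> ?P" if "h \<in> G" "X \<in> ?P" for h X
    using q_graph_AutD(3)[OF G] q_graph_Aut_image_vertices[OF assms(1) G] that by blast
  \<comment> \<open>The outer map is restricted to \<open>?P\<close>, so it acts as the image under
    \<open>g\<close> only because the image under \<open>h\<close> stays in
    \<open>?P\<close>.\<close>
  have "subspace_action \<Gamma> (g \<circ> h) = compose ?P (subspace_action \<Gamma> g) (subspace_action \<Gamma> h)"
    if "h \<in> G" for g h
    using P[OF that] by (auto simp: compose_def subspace_action_def image_comp fun_eq_iff)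
  then have "subspace_action \<Gamma> \<in> hom ((q_graph_Aut \<Gamma>)\<lparr>carrier := G\<rparr>) (BijGroup ?P)"
    using Bij by (intro homI) (auto simp: BijGroup_def q_graph_Aut_def GammaL_def)
  then show ?thesis
    unfolding group_action_def group_hom_def group_hom_axioms_def
    using group.subgroup_imp_group[OF group_q_graph_Aut assms(2)] group_BijGroup by blast
qed

theorem proposition1p7:
  fixes \<Gamma> :: "('a::{field,finite} ^ 'n) q_graph"
    and G :: "('a ^ 'n \<Rightarrow> 'a ^ 'n) set"
  assumes "is_q_graph \<Gamma>"
    and "subgroup G (q_graph_Aut \<Gamma>)"
    and "q_graph_flag_transitive G \<Gamma>"
  shows "flag_transitive_partial_linear_space
           ((q_graph_Aut \<Gamma>)\<lparr>carrier := G\<rparr>) (subspace_action \<Gamma>) (q_graph_space \<Gamma>)"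
proof -
  let ?S = "q_graph_space \<Gamma>"
  have S: "points ?S = vertices \<Gamma>" "lines ?S = edges \<Gamma>"
    by (simp_all add: q_graph_space_def)
  \<comment> \<open>Incident point-line pairs are exactly the flags of the q-graph, and on vertices
    and edges the restricted action is the plain image, so the element moving one flag to the other
    serves as witness.\<close>
  have "\<exists>g\<in>G. subspace_action \<Gamma> g X = Y \<and> subspace_action \<Gamma> g U = W"
    if "X \<in> vertices \<Gamma>" "U \<in> edges \<Gamma>" "Y \<in> vertices \<Gamma>" "W \<in> edges \<Gamma>"
      "(X, U) \<in> incidence ?S" "(Y, W) \<in> incidence ?S" for X U Y W
    using assms(3) that incidence_q_graph_space_iff[OF assms(1)]
    by (simp add: q_graph_flag_transitive_def subspace_action_def)
  then show ?thesis
    unfolding flag_transitive_partial_linear_space_def S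
    using partial_linear_space_q_graph_space[OF assms(1)]
      group_action_subspace_action[OF assms(1,2)]
      subspace_action_incidence_automorphism[OF assms(1) subgroup.mem_carrier[OF assms(2)]]
    by simp
qed

end
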